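(* Let $g_1>g_2$ be normalized channel gains, $\hat P$ the peak power, and let a triple $(\lambda,\delta,\mu)$ with $\lambda\ge 0$, $\delta\ge 0$, $\mu\ge 0$ be given. Consider the problem of maximizing $$\bar{\mathcal L}(p_1,p_2)=(1+\delta)\log_2(1+p_1g_1)+(1+\mu)\log_2\Big(1+\frac{p_2g_2}{p_1g_2+1}\Big)-\lambda(p_1+p_2)$$ over $\{(p_1,p_2): p_1\ge 0,\ p_2\ge 0,\ p_1+p_2\le\hat P\}$. Then the optimal power allocation is $$(p_1^\ast,p_2^\ast)=\arg\max\big\{\bar{\mathcal L}(0,0),\ \bar{\mathcal L}(0,\hat P),\ \bar{\mathcal L}(\hat P,0),\ \bar{\mathcal L}(p_{i,1},p_{i,2})\big\},\quad i\in\{1,2,3,4\},$$ where $$\begin{aligned} &p_{1,1}=0, && p_{1,2}=\Big[\tfrac{1+\mu}{\lambda\ln 2}-\tfrac1{g_2}\Big]_0^{\hat P},\\ &p_{2,1}=\Big[\tfrac{1+\delta}{\lambda\ln 2}-\tfrac1{g_1}\Big]_0^{\hat P}, && p_{2,2}=0,\\ &p_{3,1}=\Big[\tfrac{(1+\mu)/g_1-(1+\delta)/g_2}{\delta-\mu}\Big]_0^{\hat P}, && p_{3,2}=\Big[\hat P-\tfrac{(1+\mu)/g_1-(1+\delta)/g_2}{\delta-\mu}\Big]_0^{\hat P},\\ &p_{4,1}=\tfrac{(1+\mu)/g_1-(1+\delta)/g_2}{\delta-\mu}, && p_{4,2}=\tfrac{1+\mu}{\lambda\ln2}-\tfrac1{g_2}-\tfrac{(1+\mu)/g_1-(1+\delta)/g_2}{\delta-\mu},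 \end{aligned}$$ the last pair $(p_{4,1},p_{4,2})$ being used if $p_{4,1}\ge0$, $p_{4,2}\ge 0$ and $p_{4,1}+p_{4,2}\le\hat P$, and being not applicable (no candidate) otherwise.
   Context: Notation: $[x]_a^b=\max(\min(x,b),a)$. The function $\bar{\mathcal L}$ is the per-fading-state Lagrangian of the ergodic sum-rate maximization for a two-user downlink NOMA system: $g_k=|h_k|^2/\sigma_k^2$ is the normalized channel gain of user $k$, $p_1,p_2$ are the transmit powers for users 1 and 2, $\hat P$ is the peak total power, $\lambda$ is the multiplier of the average power constraint, and $\delta,\mu$ are the multipliers of the minimum average rate constraints of users 1 and 2. Since $g_1>g_2$, user 1 decodes free of interference after successive interference cancellation, with rate $\log_2(1+p_1g_1)$, and user 2 treats interference as noise, with rate $\log_2(1+\frac{p_2g_2}{p_1g_2+1})$. *)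

theory Defs
  imports Complex_Main
begin

definition clip :: "real \<Rightarrow> real \<Rightarrow> real \<Rightarrow> real" where
  "clip a b x = max (min x b) a"

definition lagr :: "real \<Rightarrow> real \<Rightarrow> real \<Rightarrow> real \<Rightarrow> real \<Rightarrow> real \<times> real \<Rightarrow> real" where
  "lagr g1 g2 lam del mu = (\<lambda>(p1, p2).
     (1 + del) * log 2 (1 + p1 * g1)
   + (1 + mu) * log 2 (1 + p2 * g2 / (p1 * g2 + 1))
   - lam * (p1 + p2))"

definition feasible :: "real \<Rightarrow> (real \<times> real) set" where
  "feasible P = {(p1, p2). 0 \<le> p1 \<and> 0 \<le> p2 \<and> p1 + p2 \<le> P}"

text \<open>
  The multiplier \<open>lam\<close> may vanish and \<open>del\<close>, \<open>mu\<close> may coincide, so the divisions below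
  are guarded and do not rely on \<open>x / 0 = 0\<close>. A quotient with a positive numerator and
  \<open>lam = 0\<close> in the denominator is read as plus infinity, which is clipped to \<open>P\<close>.
\<close>

definition cand1 :: "real \<Rightarrow> real \<Rightarrow> real \<Rightarrow> real \<Rightarrow> real \<times> real" where
  "cand1 g2 P lam mu =
     (0, if lam = 0 then P else clip 0 P ((1 + mu) / (lam * ln 2) - 1 / g2))"

definition cand2 :: "real \<Rightarrow> real \<Rightarrow> real \<Rightarrow> real \<Rightarrow> real \<times> real" where
  "cand2 g1 P lam del =
     (if lam = 0 then P else clip 0 P ((1 + del) / (lam * ln 2) - 1 / g1), 0)"

definition crit1 :: "real \<Rightarrow> real \<Rightarrow> real \<Rightarrow> real \<Rightarrow> real" where
  "crit1 g1 g2 del mu = ((1 + mu) / g1 - (1 + del) / g2) / (del - mu)"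

text \<open>
  For \<open>del = mu\<close> and \<open>g1 > g2 > 0\<close> the numerator of \<open>crit1\<close> is negative and the quotient
  is infinite. It is read as minus infinity; the opposite sign would give \<open>(P, 0)\<close> in
  \<open>cand3\<close>. Both pairs are elements of \<open>candidates\<close> anyway.
\<close>

definition cand3 :: "real \<Rightarrow> real \<Rightarrow> real \<Rightarrow> real \<Rightarrow> real \<Rightarrow> real \<times> real" where
  "cand3 g1 g2 P del mu =
     (if del = mu then (0, P)
      else (clip 0 P (crit1 g1 g2 del mu), clip 0 P (P - crit1 g1 g2 del mu)))"

definition cand4 :: "real \<Rightarrow> real \<Rightarrow> real \<Rightarrow> real \<Rightarrow> real \<Rightarrow> real \<times> real" where
  "cand4 g1 g2 lam del mu =
     (crit1 g1 g2 del mu,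
      (1 + mu) / (lam * ln 2) - 1 / g2 - crit1 g1 g2 del mu)"

text \<open>
  \<open>cand4\<close> has an infinite coordinate, hence is not applicable, if \<open>lam = 0\<close> or \<open>del = mu\<close>.
\<close>

definition candidates ::
  "real \<Rightarrow> real \<Rightarrow> real \<Rightarrow> real \<Rightarrow> real \<Rightarrow> real \<Rightarrow> (real \<times> real) set" where
  "candidates g1 g2 P lam del mu =
     {(0, 0), (0, P), (P, 0), cand1 g2 P lam mu, cand2 g1 P lam del, cand3 g1 g2 P del mu}
     \<union> (if lam \<noteq> 0 \<and> del \<noteq> mu \<and> cand4 g1 g2 lam del mu \<in> feasible P
        then {cand4 g1 g2 lam del mu} else {})"

end

(* With s = p1 + p2 the Lagrangian separates as F(p1) + G(s) on the triangle 0 <= p1 <= s <= P,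
   where F(x) = (1+del) log2(1 + x g1) - (1+mu) log2(1 + x g2) and
   G(s) = (1+mu) log2(1 + s g2) - lam s.  A maximizer exists by compactness.  First-order
   conditions force it to be a candidate: F' vanishes only at crit1 and G' only at
   (1+mu)/(lam ln 2) - 1/g2, so cand4 is the stationary point in the interior, cand1, cand2 and
   cand3 are the stationary points on the edges p1 = 0, p2 = 0 and s = P, and the remaining
   candidates are the vertices. *)
theory Submission
  imports Defs "HOL-Analysis.Analysis"
begin

text \<open>Two functions occur because the derivative is taken of a closed form \<open>h\<close>
  that need agree with the Lagrangian slice \<open>f\<close> only on the open interval, where both
  powers are nonnegative.\<close>

lemma stationary_at_interior_max:
  fixes f h :: "real \<Rightarrow> real"
  assumes "a < x" "x < b" and max: "\<And>y. a < y \<Longrightarrow> y < b \<Longrightarrow> f y \<le> f x"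
    and der: "(h has_real_derivative l) (at x)" and eq: "\<And>y. a < y \<Longrightarrow> y < b \<Longrightarrow> f y = h y"
  shows "l = 0"
proof (rule DERIV_local_max[OF der])
  show "0 < min (x - a) (b - x)" using assms by simp
  show "\<forall>y. \<bar>x - y\<bar> < min (x - a) (b - x) \<longrightarrow> h y \<le> h x"
  proof (intro allI impI)
    fix y assume "\<bar>x - y\<bar> < min (x - a) (b - x)"
    then have "a < y" "y < b" by linarith+
    then show "h y \<le> h x" using max[of y] eq[of y] eq[of x] assms(1,2) by simp
  qed
qed

text \<open>The argument of user 2's logarithm is the quotient of 1 + s \<open>g2\<close> and 1 +
  \<open>p1 * g2\<close> with s = \<open>p1 + p2\<close>, so its logarithm splits into a part in s
  and a part in \<open>p1\<close>.\<close>

lemma lagr_separated: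
  assumes "0 < g2" "0 \<le> p1" "0 \<le> p2"
  shows "lagr g1 g2 lam del mu (p1, p2) = (1 + del) * log 2 (1 + p1 * g1)
    + (1 + mu) * (log 2 (1 + (p1 + p2) * g2) - log 2 (1 + p1 * g2)) - lam * (p1 + p2)"
proof -
  have pos: "0 < 1 + p1 * g2" "0 < 1 + (p1 + p2) * g2"
    using assms by (simp_all add: add_pos_nonneg)
  have "1 + p2 * g2 / (p1 * g2 + 1) = (1 + (p1 + p2) * g2) / (1 + p1 * g2)"
    using pos by (simp add: field_simps)
  then show ?thesis
    using pos by (simp add: lagr_def log_divide)
qed

lemma compact_feasible: "compact (feasible P)"
proof -
  have "feasible P = ({0..P} \<times> {0..P}) \<inter> {p. fst p + snd p \<le> P}"
    by (auto simp: feasible_def)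
  moreover have "closed {p :: real \<times> real. fst p + snd p \<le> P}"
    by (intro closed_Collect_le continuous_intros)
  ultimately show ?thesis
    by (simp add: compact_Times compact_Int_closed)
qed

lemma continuous_on_lagr:
  assumes "0 < g2" "g2 < g1"
  shows "continuous_on (feasible P) (lagr g1 g2 lam del mu)"
proof -
  have pos: "0 < 1 + fst p * g1" "0 < 1 + snd p * g2 / (fst p * g2 + 1)" "0 < fst p * g2 + 1"
    if "p \<in> feasible P" for p
    using that assms by (auto simp: feasible_def add_pos_nonneg add_nonneg_pos)
  show ?thesis
    unfolding lagr_def case_prod_unfold log_def
    using pos by (intro continuous_intros) (auto simp: less_imp_neq[THEN not_sym])
qed

text \<open>Clipping both coordinates of \<open>cand3\<close> keeps their sum equal to
  \<open>P\<close>: a value of \<open>crit1\<close> outside the range yields \<open>(0, P)\<close>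
  or \<open>(P, 0)\<close>.\<close>

lemma candidates_subset_feasible:
  assumes "0 \<le> P"
  shows "candidates g1 g2 P lam del mu \<subseteq> feasible P"
  using assms
  by (auto simp: candidates_def feasible_def cand1_def cand2_def cand3_def clip_def
      split: if_splits)

context
  fixes g1 g2 P lam del mu p1 p2 :: real
  assumes g: "0 < g2" "g2 < g1" and nonneg: "0 \<le> lam" "0 \<le> del" "0 \<le> mu"
    and max: "is_arg_max (lagr g1 g2 lam del mu) (\<lambda>q. q \<in> feasible P) (p1, p2)"
begin

lemma maximizer_feasible: "0 \<le> p1" "0 \<le> p2" "p1 + p2 \<le> P"
  using max by (auto simp: is_arg_max_def feasible_def)

lemma maximizer_ge:
  "0 \<le> x \<Longrightarrow> 0 \<le> y \<Longrightarrow> x + y \<le> P \<Longrightarrow>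
    lagr g1 g2 lam del mu (x, y) \<le> lagr g1 g2 lam del mu (p1, p2)"
  using max by (auto simp: is_arg_max_linorder feasible_def)

text \<open>Moving \<open>p2\<close> alone changes only the sum, so G' vanishes there. Since
  \<open>p1 = 0\<close> is allowed, this serves both the edge of \<open>cand1\<close> and the
  interior. For \<open>lam = 0\<close>, G would be strictly increasing.\<close>

lemma stationary_in_sum:
  assumes "0 < p2" "p1 + p2 < P"
  shows "lam \<noteq> 0" "p1 + p2 = (1 + mu) / (lam * ln 2) - 1 / g2"
proof -
  have pos: "0 < 1 + (p1 + p2) * g2"
    using g maximizer_feasible by (simp add: add_pos_nonneg)
  let ?f = "\<lambda>y. (1 + del) * log 2 (1 + p1 * g1)
    + (1 + mu) * (log 2 (1 + (p1 + y) * g2) - log 2 (1 + p1 * g2)) - lam * (p1 + y)"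
  have "(?f has_real_derivative (1 + mu) * (g2 / (ln 2 * (1 + (p1 + p2) * g2))) - lam) (at p2)"
    using pos by (auto intro!: derivative_eq_intros simp: divide_simps)
  then have "(1 + mu) * (g2 / (ln 2 * (1 + (p1 + p2) * g2))) - lam = 0"
    by (rule stationary_at_interior_max
        [where a = 0 and b = "P - p1" and f = "\<lambda>y. lagr g1 g2 lam del mu (p1, y)", rotated 3])
      (use assms g maximizer_feasible maximizer_ge in \<open>auto simp: lagr_separated\<close>)
  then have eq: "(1 + mu) * g2 = lam * (ln 2 * (1 + (p1 + p2) * g2))"
    using pos by (simp add: divide_eq_eq)
  have "0 < (1 + mu) * g2" using g nonneg by simp
  then show nz: "lam \<noteq> 0" using eq by auto
  have "(1 + mu) / (lam * ln 2) = (1 + (p1 + p2) * g2) / g2"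
    using eq nz g by (simp add: frac_eq_eq mult_ac)
  then show "p1 + p2 = (1 + mu) / (lam * ln 2) - 1 / g2"
    using g by (simp add: add_divide_distrib)
qed

text \<open>For \<open>p2 = 0\<close> the two logarithms weighted by \<open>1 + mu\<close> cancel,
  which leaves a single-user problem in \<open>p1\<close>.\<close>

lemma stationary_on_edge:
  assumes "0 < p1" "p1 < P" "p2 = 0"
  shows "lam \<noteq> 0" "p1 = (1 + del) / (lam * ln 2) - 1 / g1"
proof -
  have pos: "0 < 1 + p1 * g1" using g assms by (simp add: add_pos_nonneg)
  have "((\<lambda>x. (1 + del) * log 2 (1 + x * g1) - lam * x) has_real_derivative
      (1 + del) * (g1 / (ln 2 * (1 + p1 * g1))) - lam) (at p1)"
    using pos by (auto intro!: derivative_eq_intros simp: divide_simps)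
  then have "(1 + del) * (g1 / (ln 2 * (1 + p1 * g1))) - lam = 0"
    by (rule stationary_at_interior_max
        [where a = 0 and b = P and f = "\<lambda>x. lagr g1 g2 lam del mu (x, 0)", rotated 3])
      (use assms g maximizer_ge[of _ 0] in \<open>auto simp: lagr_separated\<close>)
  then have eq: "(1 + del) * g1 = lam * (ln 2 * (1 + p1 * g1))"
    using pos by (simp add: divide_eq_eq)
  have "0 < (1 + del) * g1" using g nonneg by simp
  then show nz: "lam \<noteq> 0" using eq by auto
  have "(1 + del) / (lam * ln 2) = (1 + p1 * g1) / g1"
    using eq nz g by (simp add: frac_eq_eq mult_ac)
  then show "p1 = (1 + del) / (lam * ln 2) - 1 / g1"
    using g by (simp add: add_divide_distrib)
qed

text \<open>Shifting power between the users at constant sum leaves G unchanged, so F' vanishes. The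
  sum may equal \<open>P\<close>, so this serves both \<open>cand3\<close> and
  \<open>cand4\<close>.\<close>

lemma stationary_at_fixed_sum:
  assumes "0 < p1" "0 < p2"
  shows "del \<noteq> mu" "p1 = crit1 g1 g2 del mu"
proof -
  have pos: "0 < 1 + p1 * g1" "0 < 1 + p1 * g2" using g assms by (simp_all add: add_pos_nonneg)
  let ?s = "p1 + p2"
  let ?f = "\<lambda>x. (1 + del) * log 2 (1 + x * g1)
    + (1 + mu) * (log 2 (1 + ?s * g2) - log 2 (1 + x * g2)) - lam * ?s"
  have "(?f has_real_derivative
      (1 + del) * (g1 / (ln 2 * (1 + p1 * g1))) - (1 + mu) * (g2 / (ln 2 * (1 + p1 * g2)))) (at p1)"
    using pos by (auto intro!: derivative_eq_intros simp: divide_simps)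
  then have "(1 + del) * (g1 / (ln 2 * (1 + p1 * g1))) - (1 + mu) * (g2 / (ln 2 * (1 + p1 * g2))) = 0"
    by (rule stationary_at_interior_max
        [where a = 0 and b = ?s and f = "\<lambda>x. lagr g1 g2 lam del mu (x, ?s - x)", rotated 3])
      (use assms g maximizer_feasible maximizer_ge[of x "?s - x" for x] in \<open>auto simp: lagr_separated\<close>)
  then have "(1 + del) * g1 * (1 + p1 * g2) = (1 + mu) * g2 * (1 + p1 * g1)"
    using pos by (simp add: frac_eq_eq)
  \<comment> \<open>Both terms in \<open>p1\<close> carry the factor \<open>g1 * g2\<close>, so the
    condition is linear in \<open>p1\<close>.\<close>
  then have eq: "p1 * (del - mu) * (g1 * g2) = (1 + mu) * g2 - (1 + del) * g1"
    by (simp add: algebra_simps)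
  show ne: "del \<noteq> mu"
  proof
    assume "del = mu"
    then have "(1 + mu) * (g2 - g1) = 0" using eq by (simp add: algebra_simps)
    then show False using g nonneg by simp
  qed
  have "p1 * (del - mu) = (1 + mu) / g1 - (1 + del) / g2"
    using eq g by (simp add: divide_simps mult_ac)
  then show "p1 = crit1 g1 g2 del mu"
    using ne by (simp add: crit1_def eq_divide_eq)
qed

lemma maximizer_candidate: "(p1, p2) \<in> candidates g1 g2 P lam del mu"
proof -
  note feas = maximizer_feasible
  \<comment> \<open>The cases are the vertices, the three open edges and the interior. On the edges
    the stationary value already lies between 0 and \<open>P\<close>, so clipping does not change
    it.\<close>
  consider "p1 = 0" "p2 = 0 \<or> p2 = P" | "p1 = 0" "0 < p2" "p2 < P" | "p1 = P" "p2 = 0"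
    | "0 < p1" "p1 < P" "p2 = 0" | "0 < p1" "0 < p2" "p1 + p2 = P"
    | "0 < p1" "0 < p2" "p1 + p2 < P"
    using feas by linarith
  then show ?thesis
  proof cases
    case 2
    then have "(p1, p2) = cand1 g2 P lam mu"
      using stationary_in_sum by (simp add: cand1_def clip_def)
    then show ?thesis by (simp add: candidates_def)
  next
    case 4
    then have "(p1, p2) = cand2 g1 P lam del"
      using stationary_on_edge by (simp add: cand2_def clip_def)
    then show ?thesis by (simp add: candidates_def)
  next
    case 5
    then have "(p1, p2) = cand3 g1 g2 P del mu"
      using stationary_at_fixed_sum by (auto simp: cand3_def clip_def)
    then show ?thesis by (simp add: candidates_def)
  next
    case 6
    then have "(p1, p2) = cand4 g1 g2 lam del mu"
      using stationary_at_fixed_sum stationary_in_sum by (simp add: cand4_def)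
    moreover have "(p1, p2) \<in> feasible P" using feas by (simp add: feasible_def)
    ultimately show ?thesis
      using 6 stationary_at_fixed_sum(1) stationary_in_sum(1) by (simp add: candidates_def)
  qed (auto simp: candidates_def)
qed

end

theorem proposition3p1:
  fixes g1 g2 P lam del mu :: real
  assumes "0 < g2" and "g2 < g1"
    and "0 \<le> P"
    and "0 \<le> lam" and "0 \<le> del" and "0 \<le> mu"
  shows "(\<exists>p. is_arg_max (lagr g1 g2 lam del mu) (\<lambda>q. q \<in> feasible P) p)
    \<and> (\<forall>p. is_arg_max (lagr g1 g2 lam del mu) (\<lambda>q. q \<in> feasible P) p
         \<longleftrightarrow> is_arg_max (lagr g1 g2 lam del mu) (\<lambda>q. q \<in> candidates g1 g2 P lam del mu) p)"
proof -
  have "(0, 0) \<in> feasible P" using \<open>0 \<le> P\<close> by (simp add: feasible_def)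
  then have "feasible P \<noteq> {}" by blast
  then obtain m where m: "is_arg_max (lagr g1 g2 lam del mu) (\<lambda>q. q \<in> feasible P) m"
    using continuous_attains_sup[OF compact_feasible _ continuous_on_lagr] assms(1,2)
    by (metis is_arg_max_linorder)
  have sub: "candidates g1 g2 P lam del mu \<subseteq> feasible P"
    using candidates_subset_feasible assms by blast
  have cand: "p \<in> candidates g1 g2 P lam del mu"
    if "is_arg_max (lagr g1 g2 lam del mu) (\<lambda>q. q \<in> feasible P) p" for p
    using that maximizer_candidate assms by (cases p) blast
  show ?thesis
    \<comment> \<open>The maximizer \<open>m\<close> is itself a candidate, so both sets have the
      same maximum value; a best candidate is at least as good as \<open>m\<close>, hence optimal on
      the triangle.\<close>
    using m sub cand cand[OF m] unfolding is_arg_max_linorder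
    by (meson order_trans subsetD)
qed

end
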